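(* Let $\Omega\subseteq\mathbb{R}^m$ be a non-empty open set and $1<q<\infty$. Then the closure of $L_q(\Omega)$ in $L_{q,\infty}(\Omega)$ is $L_{q,0}(\Omega)$.
   Context: $m\geq2$; $\mathcal{L}^m$ is Lebesgue measure. For a Borel-measurable $f:\Omega\to\mathbb{R}$ and $y>0$ put $\boldsymbol\varepsilon_q(f,y)=\mathcal{L}^m(\{x\in\Omega:|f(x)|>y\})\cdot y^q$. The weak Lebesgue space $L_{q,\infty}(\Omega)$ consists of (classes of) those $f$ with $\sup_{y>0}\boldsymbol\varepsilon_q(f,y)<\infty$, with the quasi-norm $\|f\|_{L_{q,\infty}}=(\sup_{y>0}\boldsymbol\varepsilon_q(f,y))^{1/q}$; the closure is taken with respect to this quasi-norm. $L_{q,0}(\Omega)$ consists of (classes of) those Borel-measurable $f$ with $\lim_{y\to0^+}\boldsymbol\varepsilon_q(f,y)=0=\lim_{y\to\infty}\boldsymbol\varepsilon_q(f,y)$. *)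

theory Defs
  imports "HOL-Analysis.Analysis"
begin

text \<open>
  Functions on \<open>\<Omega>\<close> are represented by total functions of which only the values on \<open>\<Omega>\<close> matter:
  classes are taken modulo equality almost everywhere on \<open>\<Omega>\<close>, so values outside \<open>\<Omega>\<close> are
  identified as well.
\<close>

abbreviation leb_on :: "'a::euclidean_space set \<Rightarrow> 'a measure" where
  "leb_on \<Omega> \<equiv> restrict_space lborel \<Omega>"

definition ae_rel :: "'a::euclidean_space set \<Rightarrow> (('a \<Rightarrow> real) \<times> ('a \<Rightarrow> real)) set" where
  "ae_rel \<Omega> = {(f, g). f \<in> borel_measurable (leb_on \<Omega>) \<and> g \<in> borel_measurable (leb_on \<Omega>) \<and>
     (AE x in leb_on \<Omega>. f x = g x)}"

lemma equiv_ae_rel: "equiv (borel_measurable (leb_on \<Omega>)) (ae_rel \<Omega>)"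
proof (rule equivI)
  show "ae_rel \<Omega> \<subseteq> borel_measurable (leb_on \<Omega>) \<times> borel_measurable (leb_on \<Omega>)"
    by (auto simp: ae_rel_def)
  show "refl_on (borel_measurable (leb_on \<Omega>)) (ae_rel \<Omega>)"
    by (auto simp: ae_rel_def refl_on_def)
  show "sym (ae_rel \<Omega>)"
    by (auto simp: ae_rel_def sym_def eq_commute)
  show "trans (ae_rel \<Omega>)"
  proof (rule transI)
    fix f g h :: "'a \<Rightarrow> real"
    assume *: "(f, g) \<in> ae_rel \<Omega>" "(g, h) \<in> ae_rel \<Omega>"
    then have "AE x in leb_on \<Omega>. f x = g x" "AE x in leb_on \<Omega>. g x = h x"
      by (simp_all add: ae_rel_def)
    then have "AE x in leb_on \<Omega>. f x = h x" by eventually_elim simp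
    then show "(f, h) \<in> ae_rel \<Omega>" using * by (simp add: ae_rel_def)
  qed
qed

definition eps :: "'a::euclidean_space set \<Rightarrow> real \<Rightarrow> ('a \<Rightarrow> real) \<Rightarrow> real \<Rightarrow> ennreal" where
  "eps \<Omega> q f y = emeasure lborel {x \<in> \<Omega>. \<bar>f x\<bar> > y} * ennreal (y powr q)"

definition L_space :: "'a::euclidean_space set \<Rightarrow> real \<Rightarrow> ('a \<Rightarrow> real) set set" where
  "L_space \<Omega> q =
     {f \<in> borel_measurable (leb_on \<Omega>).
        (\<integral>\<^sup>+x. ennreal (\<bar>f x\<bar> powr q) \<partial>leb_on \<Omega>) < \<infinity>} // ae_rel \<Omega>"

definition weak_L_space :: "'a::euclidean_space set \<Rightarrow> real \<Rightarrow> ('a \<Rightarrow> real) set set" where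
  "weak_L_space \<Omega> q =
     {f \<in> borel_measurable (leb_on \<Omega>). (SUP y\<in>{0<..}. eps \<Omega> q f y) < \<infinity>} // ae_rel \<Omega>"

definition L0_space :: "'a::euclidean_space set \<Rightarrow> real \<Rightarrow> ('a \<Rightarrow> real) set set" where
  "L0_space \<Omega> q =
     {f \<in> borel_measurable (leb_on \<Omega>).
        (eps \<Omega> q f \<longlongrightarrow> 0) (at_right 0) \<and> (eps \<Omega> q f \<longlongrightarrow> 0) at_top} // ae_rel \<Omega>"

text \<open>The conversion to a real number is harmless: the supremum is finite on the weak space.\<close>

definition weak_norm_fun :: "'a::euclidean_space set \<Rightarrow> real \<Rightarrow> ('a \<Rightarrow> real) \<Rightarrow> real" where
  "weak_norm_fun \<Omega> q f = enn2real (SUP y\<in>{0<..}. eps \<Omega> q f y) powr (1 / q)"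

definition weak_norm :: "'a::euclidean_space set \<Rightarrow> real \<Rightarrow> ('a \<Rightarrow> real) set \<Rightarrow> real" where
  "weak_norm \<Omega> q F = the_elem (weak_norm_fun \<Omega> q ` F)"

definition class_diff ::
  "'a::euclidean_space set \<Rightarrow> ('a \<Rightarrow> real) set \<Rightarrow> ('a \<Rightarrow> real) set \<Rightarrow> ('a \<Rightarrow> real) set" where
  "class_diff \<Omega> F G = (\<Union>f\<in>F. \<Union>g\<in>G. ae_rel \<Omega> `` {\<lambda>x. f x - g x})"

lemma eps_cong_ae:
  assumes "open \<Omega>" "(f, g) \<in> ae_rel \<Omega>"
  shows "eps \<Omega> q f = eps \<Omega> q g"
proof
  fix y
  have f[measurable]: "f \<in> borel_measurable (leb_on \<Omega>)"
    and g[measurable]: "g \<in> borel_measurable (leb_on \<Omega>)"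
    and ae: "AE x in leb_on \<Omega>. f x = g x"
    using assms(2) by (auto simp: ae_rel_def)
  have \<Omega>: "\<Omega> \<in> sets lborel" using assms(1) by simp
  have sp: "space (leb_on \<Omega>) = \<Omega>" by (simp add: space_restrict_space)
  have eq: "emeasure lborel {x \<in> \<Omega>. \<bar>h x\<bar> > y} = emeasure (leb_on \<Omega>) {x \<in> \<Omega>. \<bar>h x\<bar> > y}"
    for h :: "'a \<Rightarrow> real"
    using \<Omega> by (intro emeasure_restrict_space[symmetric]) auto
  have "{x \<in> space (leb_on \<Omega>). \<bar>f x\<bar> > y} \<in> sets (leb_on \<Omega>)"
    "{x \<in> space (leb_on \<Omega>). \<bar>g x\<bar> > y} \<in> sets (leb_on \<Omega>)"
    by measurable
  then have "emeasure (leb_on \<Omega>) {x \<in> \<Omega>. \<bar>f x\<bar> > y} = emeasure (leb_on \<Omega>) {x \<in> \<Omega>. \<bar>g x\<bar> > y}"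
    using ae by (intro emeasure_eq_AE) (auto simp: sp)
  then show "eps \<Omega> q f y = eps \<Omega> q g y"
    by (simp add: eps_def eq)
qed

lemma weak_norm_class:
  assumes "open \<Omega>" "f \<in> borel_measurable (leb_on \<Omega>)"
  shows "weak_norm \<Omega> q (ae_rel \<Omega> `` {f}) = weak_norm_fun \<Omega> q f"
proof -
  have "weak_norm_fun \<Omega> q g = weak_norm_fun \<Omega> q f" if "g \<in> ae_rel \<Omega> `` {f}" for g
  proof -
    have "(f, g) \<in> ae_rel \<Omega>" using that by (simp only: Image_singleton_iff)
    then show ?thesis by (simp only: weak_norm_fun_def eps_cong_ae[OF assms(1)])
  qed
  then have "weak_norm_fun \<Omega> q ` (ae_rel \<Omega> `` {f}) =
      (\<lambda>_. weak_norm_fun \<Omega> q f) ` (ae_rel \<Omega> `` {f})"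
    by (intro image_cong refl)
  also have "\<dots> = {weak_norm_fun \<Omega> q f}"
    by (rule image_constant[OF equiv_class_self[OF equiv_ae_rel assms(2)]])
  finally show ?thesis by (simp only: weak_norm_def the_elem_eq)
qed

lemma class_diff_class:
  assumes "f \<in> borel_measurable (leb_on \<Omega>)" "g \<in> borel_measurable (leb_on \<Omega>)"
  shows "class_diff \<Omega> (ae_rel \<Omega> `` {f}) (ae_rel \<Omega> `` {g}) = ae_rel \<Omega> `` {\<lambda>x. f x - g x}"
proof -
  have "ae_rel \<Omega> `` {\<lambda>x. f' x - g' x} = ae_rel \<Omega> `` {\<lambda>x. f x - g x}"
    if "(f, f') \<in> ae_rel \<Omega>" "(g, g') \<in> ae_rel \<Omega>" for f' g'
  proof (rule equiv_class_eq[OF equiv_ae_rel])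
    have "AE x in leb_on \<Omega>. f x = f' x" "AE x in leb_on \<Omega>. g x = g' x"
      using that by (auto simp: ae_rel_def)
    then have "AE x in leb_on \<Omega>. f' x - g' x = f x - g x" by eventually_elim simp
    then show "(\<lambda>x. f' x - g' x, \<lambda>x. f x - g x) \<in> ae_rel \<Omega>"
      using that by (auto simp: ae_rel_def)
  qed
  then have "class_diff \<Omega> (ae_rel \<Omega> `` {f}) (ae_rel \<Omega> `` {g}) =
      (\<Union>f'\<in>ae_rel \<Omega> `` {f}. \<Union>g'\<in>ae_rel \<Omega> `` {g}. ae_rel \<Omega> `` {\<lambda>x. f x - g x})"
    unfolding class_diff_def by (intro SUP_cong refl) (simp add: Image_singleton)
  moreover have "ae_rel \<Omega> `` {f} \<noteq> {}" "ae_rel \<Omega> `` {g} \<noteq> {}"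
    using equiv_class_self[OF equiv_ae_rel assms(1)] equiv_class_self[OF equiv_ae_rel assms(2)]
    by (metis empty_iff)+
  ultimately show ?thesis by simp
qed

text \<open>
  The topology induced by the quasi-norm: a set is open iff it contains a quasi-norm ball around
  each of its points. The balls themselves need not be open.
\<close>

definition weak_open :: "'a::euclidean_space set \<Rightarrow> real \<Rightarrow> ('a \<Rightarrow> real) set set \<Rightarrow> bool" where
  "weak_open \<Omega> q U \<longleftrightarrow> U \<subseteq> weak_L_space \<Omega> q \<and>
     (\<forall>F\<in>U. \<exists>e>0. \<forall>G\<in>weak_L_space \<Omega> q. weak_norm \<Omega> q (class_diff \<Omega> G F) < e \<longrightarrow> G \<in> U)"

definition weak_topology :: "'a::euclidean_space set \<Rightarrow> real \<Rightarrow> ('a \<Rightarrow> real) set topology" where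
  "weak_topology \<Omega> q = topology (weak_open \<Omega> q)"

lemma istopology_weak_open: "istopology (weak_open \<Omega> q)"
  unfolding istopology_def
proof (intro conjI allI impI)
  fix S T assume S: "weak_open \<Omega> q S" and T: "weak_open \<Omega> q T"
  show "weak_open \<Omega> q (S \<inter> T)"
    unfolding weak_open_def
  proof (intro conjI ballI)
    show "S \<inter> T \<subseteq> weak_L_space \<Omega> q" using S by (auto simp: weak_open_def)
    fix F assume "F \<in> S \<inter> T"
    then obtain d e where "d > 0" "e > 0"
      "\<forall>G\<in>weak_L_space \<Omega> q. weak_norm \<Omega> q (class_diff \<Omega> G F) < d \<longrightarrow> G \<in> S"
      "\<forall>G\<in>weak_L_space \<Omega> q. weak_norm \<Omega> q (class_diff \<Omega> G F) < e \<longrightarrow> G \<in> T"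
      using S T unfolding weak_open_def by blast
    then show "\<exists>e>0. \<forall>G\<in>weak_L_space \<Omega> q. weak_norm \<Omega> q (class_diff \<Omega> G F) < e \<longrightarrow> G \<in> S \<inter> T"
      by (intro exI[of _ "min d e"]) auto
  qed
next
  fix \<U> assume *: "\<forall>U\<in>\<U>. weak_open \<Omega> q U"
  show "weak_open \<Omega> q (\<Union>\<U>)"
    unfolding weak_open_def
  proof (intro conjI ballI)
    show "\<Union>\<U> \<subseteq> weak_L_space \<Omega> q" using * by (auto simp: weak_open_def)
    fix F assume "F \<in> \<Union>\<U>"
    then obtain U where U: "U \<in> \<U>" "F \<in> U" by blast
    then obtain e where "e > 0"
      "\<forall>G\<in>weak_L_space \<Omega> q. weak_norm \<Omega> q (class_diff \<Omega> G F) < e \<longrightarrow> G \<in> U"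
      using * unfolding weak_open_def by blast
    then show "\<exists>e>0. \<forall>G\<in>weak_L_space \<Omega> q. weak_norm \<Omega> q (class_diff \<Omega> G F) < e \<longrightarrow> G \<in> \<Union>\<U>"
      using U by (intro exI[of _ e]) auto
  qed
qed

lemma openin_weak_topology: "openin (weak_topology \<Omega> q) U \<longleftrightarrow> weak_open \<Omega> q U"
  by (simp add: weak_topology_def istopology_weak_open)

lemma topspace_weak_topology: "topspace (weak_topology \<Omega> q) = weak_L_space \<Omega> q"
proof -
  have "weak_open \<Omega> q (weak_L_space \<Omega> q)" by (auto simp: weak_open_def intro: exI[of _ 1])
  then show ?thesis by (auto simp: topspace_def openin_weak_topology weak_open_def)
qed

end

theory Submission
  imports Defs
begin

text \<open>
  By the quasi-triangle inequality, the two limit conditions are stable under small perturbations in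
  \<open>L\<^sub>q\<^sub>,\<^sub>\<infinity>\<close>, so \<open>L\<^sub>q\<^sub>,\<^sub>0\<close> is closed; it contains \<open>L\<^sub>q\<close> by dominated convergence, since
  \<open>y\<^sup>q 1{\<bar>f\<bar> > y} \<le> \<bar>f\<bar>\<^sup>q\<close>. Conversely the truncations \<open>f 1{a < \<bar>f\<bar> \<le> b}\<close> of \<open>f \<in> L\<^sub>q\<^sub>,\<^sub>0\<close> lie in
  \<open>L\<^sub>q\<close> and converge to \<open>f\<close> as \<open>a \<rightarrow> 0\<close> and \<open>b \<rightarrow> \<infinity>\<close>.
\<close>

section \<open>Zero limits in \<open>ennreal\<close>, superlevel sets and the quasi-norm\<close>

lemma tendsto_zero_ennrealI:
  fixes f :: "'a \<Rightarrow> ennreal"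
  assumes "\<And>e::real. e > 0 \<Longrightarrow> eventually (\<lambda>x. f x \<le> ennreal e) F"
  shows "(f \<longlongrightarrow> 0) F"
proof (rule order_tendstoI)
  fix a :: ennreal assume "0 < a"
  \<comment> \<open>Passing strictly below \<open>a\<close> produces a finite bound even when
    \<open>a\<close> is infinite, so real tolerances suffice.\<close>
  then obtain b where b: "0 < b" "b < a" using dense by blast
  then obtain r where "b = ennreal r" by (cases b) auto
  with b have r: "r > 0" "ennreal r < a" by auto
  from assms[OF r(1)] show "eventually (\<lambda>x. f x < a) F"
    by eventually_elim (use r in auto)
qed auto

lemma tendsto_zero_ennrealD:
  fixes f :: "'a \<Rightarrow> ennreal"
  assumes "(f \<longlongrightarrow> 0) F" "e > (0::real)"
  shows "eventually (\<lambda>x. f x \<le> ennreal e) F"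
proof -
  have "eventually (\<lambda>x. f x < ennreal e) F"
    using assms by (intro order_tendstoD) auto
  then show ?thesis by eventually_elim auto
qed

lemma superlevel_in_sets_lborel:
  fixes f :: "'a::euclidean_space \<Rightarrow> real"
  assumes "open \<Omega>" "f \<in> borel_measurable (leb_on \<Omega>)"
  shows "{x \<in> \<Omega>. \<bar>f x\<bar> > y} \<in> sets lborel"
proof -
  note [measurable] = assms(2)
  have "{x \<in> space (leb_on \<Omega>). \<bar>f x\<bar> > y} \<in> sets (leb_on \<Omega>)"
    by measurable
  then show ?thesis
    using assms(1) by (auto simp: sets_restrict_space_iff space_restrict_space)
qed

lemma eps_le_Sup: "y > 0 \<Longrightarrow> eps \<Omega> q f y \<le> (SUP y\<in>{0<..}. eps \<Omega> q f y)"
  by (rule SUP_upper) auto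

text \<open>Where |h| exceeds \<open>y\<close>, one of |f|, |g| exceeds \<open>y / 2\<close>; the
  factor \<open>2 powr q\<close> restores \<open>y powr q\<close> from
  \<open>(y / 2) powr q\<close>. Assuming a pointwise bound instead of \<open>h = f + g\<close> lets
  the lemma both bound a difference \<open>g - f\<close> and recover \<open>f\<close> from
  \<open>g - f\<close> and \<open>g\<close>.\<close>

lemma eps_triangle:
  assumes "open \<Omega>" "f \<in> borel_measurable (leb_on \<Omega>)" "g \<in> borel_measurable (leb_on \<Omega>)"
    and le: "\<And>x. \<bar>h x\<bar> \<le> \<bar>f x\<bar> + \<bar>g x\<bar>" and "y > 0"
  shows "eps \<Omega> q h y \<le> ennreal (2 powr q) * (eps \<Omega> q f (y / 2) + eps \<Omega> q g (y / 2))"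
proof -
  let ?S = "\<lambda>f y. {x \<in> \<Omega>. \<bar>f x\<bar> > y}"
  have m: "?S f (y/2) \<in> sets lborel" "?S g (y/2) \<in> sets lborel"
    using superlevel_in_sets_lborel[OF assms(1)] assms(2,3) by blast+
  have sub: "?S h y \<subseteq> ?S f (y/2) \<union> ?S g (y/2)"
  proof
    fix x assume "x \<in> ?S h y"
    then show "x \<in> ?S f (y/2) \<union> ?S g (y/2)" using le[of x] by auto
  qed
  have "emeasure lborel (?S h y) \<le> emeasure lborel (?S f (y/2) \<union> ?S g (y/2))"
    using m sub by (intro emeasure_mono) auto
  also have "\<dots> \<le> emeasure lborel (?S f (y/2)) + emeasure lborel (?S g (y/2))"
    using m by (intro emeasure_subadditive) auto
  finally have "eps \<Omega> q h y \<le>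
      (emeasure lborel (?S f (y/2)) + emeasure lborel (?S g (y/2))) * ennreal (y powr q)"
    unfolding eps_def by (intro mult_right_mono) auto
  also have "ennreal (y powr q) = ennreal (2 powr q) * ennreal ((y/2) powr q)"
    using \<open>y > 0\<close> by (simp add: powr_divide flip: ennreal_mult)
  finally show ?thesis by (simp add: eps_def algebra_simps)
qed

text \<open>Moves between the real quasi-norm and the extended supremum, where the estimates take
  place. Finiteness matters: \<open>enn2real\<close> sends \<infinity> to 0, so an infinite supremum
  would count as small on the left.\<close>

lemma weak_norm_fun_less_iff:
  assumes "(SUP y\<in>{0<..}. eps \<Omega> q f y) < \<infinity>" "q > 0" "e > 0"
  shows "weak_norm_fun \<Omega> q f < e \<longleftrightarrow> (SUP y\<in>{0<..}. eps \<Omega> q f y) < ennreal (e powr q)"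
proof -
  obtain r where r: "r \<ge> 0" "(SUP y\<in>{0<..}. eps \<Omega> q f y) = ennreal r"
    using assms(1) by (cases "SUP y\<in>{0<..}. eps \<Omega> q f y") auto
  have "r powr (1/q) < e \<longleftrightarrow> r powr (1/q) < (e powr q) powr (1/q)"
    using assms by (simp add: powr_powr)
  also have "\<dots> \<longleftrightarrow> r < e powr q"
    using r(1) assms by (metis powr_less_mono2 powr_mono2 linorder_not_less powr_ge_zero
        zero_less_divide_1_iff less_eq_real_def)
  finally show ?thesis
    using r assms by (simp add: weak_norm_fun_def ennreal_less_iff)
qed

text \<open>A class belongs to the quotient as soon as some representative satisfies
  \<open>P\<close>; invariance of \<open>P\<close> under \<open>ae_rel\<close> carries this over to
  the given representative.\<close>

lemma quotient_ae_rel_iff: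
  assumes "\<And>f g. (f, g) \<in> ae_rel \<Omega> \<Longrightarrow> P f \<Longrightarrow> P g" "f \<in> borel_measurable (leb_on \<Omega>)"
  shows "ae_rel \<Omega> `` {f} \<in> {f \<in> borel_measurable (leb_on \<Omega>). P f} // ae_rel \<Omega> \<longleftrightarrow> P f"
proof
  assume "ae_rel \<Omega> `` {f} \<in> {f \<in> borel_measurable (leb_on \<Omega>). P f} // ae_rel \<Omega>"
  then obtain g where g: "g \<in> borel_measurable (leb_on \<Omega>)" "P g"
    "ae_rel \<Omega> `` {f} = ae_rel \<Omega> `` {g}"
    by (auto simp: quotient_def)
  then have "(g, f) \<in> ae_rel \<Omega>"
    using eq_equiv_class[OF _ equiv_ae_rel, of \<Omega> g f] assms(2) by metis
  then show "P f" using assms(1) g(2) by blast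
qed (use assms in \<open>auto simp: quotient_def\<close>)

lemma weak_L_space_class_iff:
  assumes "open \<Omega>" "f \<in> borel_measurable (leb_on \<Omega>)"
  shows "ae_rel \<Omega> `` {f} \<in> weak_L_space \<Omega> q \<longleftrightarrow> (SUP y\<in>{0<..}. eps \<Omega> q f y) < \<infinity>"
  unfolding weak_L_space_def
  by (rule quotient_ae_rel_iff) (use assms eps_cong_ae in metis)+

lemma L0_space_class_iff:
  assumes "open \<Omega>" "f \<in> borel_measurable (leb_on \<Omega>)"
  shows "ae_rel \<Omega> `` {f} \<in> L0_space \<Omega> q \<longleftrightarrow>
    (eps \<Omega> q f \<longlongrightarrow> 0) (at_right 0) \<and> (eps \<Omega> q f \<longlongrightarrow> 0) at_top"
  unfolding L0_space_def
  by (rule quotient_ae_rel_iff) (use assms eps_cong_ae in metis)+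

section \<open>The inclusion of \<open>L_space\<close> in \<open>L0_space\<close>\<close>

text \<open>Stated along sequences because dominated convergence is; both ends are treated at once,
  since the integral representation and the dominating function are the same and only the pointwise
  limit differs.\<close>

lemma eps_tendsto_zero_sequentially:
  fixes Y :: "nat \<Rightarrow> real"
  assumes "open \<Omega>" and f[measurable]: "f \<in> borel_measurable (leb_on \<Omega>)"
    and int: "(\<integral>\<^sup>+x. ennreal (\<bar>f x\<bar> powr q) \<partial>leb_on \<Omega>) < \<infinity>" and "q > 0"
    and pos: "\<And>n. Y n > 0" and Y: "Y \<longlonglongrightarrow> 0 \<or> filterlim Y at_top sequentially"
  shows "(\<lambda>n. eps \<Omega> q f (Y n)) \<longlonglongrightarrow> 0"
proof -
  let ?u = "\<lambda>n x. ennreal (Y n powr q) * indicator {x. \<bar>f x\<bar> > Y n} x"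
  have eq: "eps \<Omega> q f (Y n) = (\<integral>\<^sup>+x. ?u n x \<partial>leb_on \<Omega>)" for n
  proof -
    have m: "{x \<in> \<Omega>. \<bar>f x\<bar> > Y n} \<in> sets (leb_on \<Omega>)"
      using superlevel_in_sets_lborel[OF assms(1) f] assms(1)
      by (auto simp: sets_restrict_space_iff)
    have "(\<integral>\<^sup>+x. ?u n x \<partial>leb_on \<Omega>) =
        (\<integral>\<^sup>+x. ennreal (Y n powr q) * indicator {x \<in> \<Omega>. \<bar>f x\<bar> > Y n} x \<partial>leb_on \<Omega>)"
      by (intro nn_integral_cong) (auto simp: space_restrict_space indicator_def)
    also have "\<dots> = ennreal (Y n powr q) * emeasure (leb_on \<Omega>) {x \<in> \<Omega>. \<bar>f x\<bar> > Y n}"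
      using m by (rule nn_integral_cmult_indicator)
    also have "emeasure (leb_on \<Omega>) {x \<in> \<Omega>. \<bar>f x\<bar> > Y n} = emeasure lborel {x \<in> \<Omega>. \<bar>f x\<bar> > Y n}"
      using assms(1) by (intro emeasure_restrict_space) auto
    finally show ?thesis by (simp add: eps_def mult.commute)
  qed
  \<comment> \<open>If \<open>Y\<close> tends to 0, the factor \<open>Y n powr q\<close> vanishes in
    the limit; if \<open>Y\<close> tends to infinity, the indicator at \<open>x\<close> is
    eventually 0.\<close>
  have lim: "(\<lambda>n. ?u n x) \<longlonglongrightarrow> 0" for x
    using Y
  proof
    assume "Y \<longlonglongrightarrow> 0"
    then have "(\<lambda>n. Y n powr q) \<longlonglongrightarrow> 0 powr q"
      using pos \<open>q > 0\<close> by (intro tendsto_powr' tendsto_const) (auto simp: less_imp_le)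
    then have *: "(\<lambda>n. ennreal (Y n powr q)) \<longlonglongrightarrow> ennreal 0"
      by (intro tendsto_ennrealI) (use \<open>q > 0\<close> in simp)
    show ?thesis
      by (rule tendsto_sandwich[OF _ _ tendsto_const *[unfolded ennreal_0]])
        (auto simp: indicator_def)
  next
    assume "filterlim Y at_top sequentially"
    then have "eventually (\<lambda>n. Y n > \<bar>f x\<bar>) sequentially"
      by (simp add: filterlim_at_top_dense)
    then have "eventually (\<lambda>n. ?u n x = 0) sequentially"
      by eventually_elim auto
    then show ?thesis by (rule tendsto_eventually)
  qed
  have "(\<lambda>n. \<integral>\<^sup>+x. ?u n x \<partial>leb_on \<Omega>) \<longlonglongrightarrow> (\<integral>\<^sup>+x. 0 \<partial>leb_on \<Omega>)"
  proof (rule nn_integral_dominated_convergence[where w = "\<lambda>x. ennreal (\<bar>f x\<bar> powr q)"])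
    show "AE x in leb_on \<Omega>. ?u n x \<le> ennreal (\<bar>f x\<bar> powr q)" for n
      using pos[of n] \<open>q > 0\<close>
      by (intro AE_I2) (auto simp: indicator_def intro!: ennreal_leI powr_mono2)
  qed (use lim int in \<open>measurable, auto\<close>)
  then show ?thesis by (simp add: eq)
qed

lemma L_space_subset_L0_space:
  assumes "open \<Omega>" "q > 0"
  shows "L_space \<Omega> q \<subseteq> L0_space \<Omega> q"
proof
  fix F assume "F \<in> L_space \<Omega> q"
  then obtain f where f: "f \<in> borel_measurable (leb_on \<Omega>)" "F = ae_rel \<Omega> `` {f}"
    "(\<integral>\<^sup>+x. ennreal (\<bar>f x\<bar> powr q) \<partial>leb_on \<Omega>) < \<infinity>"
    by (auto simp: L_space_def quotient_def)
  note seq = eps_tendsto_zero_sequentially[OF assms(1) f(1,3) assms(2)]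
  have "(eps \<Omega> q f \<longlongrightarrow> 0) (at_right 0)"
    using seq by (intro tendsto_at_right_sequentially[of 0 1]) auto
  moreover have "(eps \<Omega> q f \<longlongrightarrow> 0) at_top"
  proof (rule tendsto_at_topI_sequentially)
    fix X :: "nat \<Rightarrow> real" assume X: "filterlim X at_top sequentially"
    \<comment> \<open>The first terms of \<open>X\<close> may fail to be positive, as the sequential
      lemma requires; \<open>max 1 (X n)\<close> is positive and eventually agrees with
      \<open>X n\<close>.\<close>
    then have "eventually (\<lambda>n. X n \<ge> 1) sequentially" by (simp add: filterlim_at_top)
    then have ev: "eventually (\<lambda>n. max 1 (X n) = X n) sequentially"
      by eventually_elim simp
    have "filterlim (\<lambda>n. max 1 (X n)) at_top sequentially"
      using X by (rule filterlim_at_top_mono) auto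
    then have "(\<lambda>n. eps \<Omega> q f (max 1 (X n))) \<longlonglongrightarrow> 0"
      by (intro seq) (auto simp: less_max_iff_disj)
    moreover have "eventually (\<lambda>n. eps \<Omega> q f (max 1 (X n)) = eps \<Omega> q f (X n)) sequentially"
      using ev by eventually_elim simp
    ultimately show "(\<lambda>n. eps \<Omega> q f (X n)) \<longlonglongrightarrow> 0"
      by (rule Lim_transform_eventually)
  qed
  ultimately show "F \<in> L0_space \<Omega> q"
    using L0_space_class_iff[OF assms(1) f(1)] f(2) by blast
qed

section \<open>Density of \<open>L_space\<close> in \<open>L0_space\<close> by truncation\<close>

lemma eps_small_outside:
  assumes "(eps \<Omega> q f \<longlongrightarrow> 0) (at_right 0)" "(eps \<Omega> q f \<longlongrightarrow> 0) at_top" "e > 0"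
  obtains a b where "0 < a" "a < b" "\<And>y. 0 < y \<Longrightarrow> y \<le> a \<Longrightarrow> eps \<Omega> q f y \<le> ennreal e"
    "\<And>y. y \<ge> b \<Longrightarrow> eps \<Omega> q f y \<le> ennreal e"
proof -
  obtain a where a: "a > 0" "\<And>y. 0 < y \<Longrightarrow> y < a \<Longrightarrow> eps \<Omega> q f y \<le> ennreal e"
    using tendsto_zero_ennrealD[OF assms(1,3)] by (auto simp: eventually_at_right_field)
  obtain b where b: "\<And>y. y \<ge> b \<Longrightarrow> eps \<Omega> q f y \<le> ennreal e"
    using tendsto_zero_ennrealD[OF assms(2,3)] by (auto simp: eventually_at_top_linorder)
  show ?thesis
    \<comment> \<open>Halving \<open>a\<close> turns the strict bound \<open>y < a\<close> into a
      non-strict one, and the maximum with \<open>a\<close> guarantees that the two thresholds are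
      in order.\<close>
    using a b by (intro that[of "a/2" "max b a"]) auto
qed

lemma emeasure_superlevel_finite:
  assumes "y > 0" "eps \<Omega> q f y < \<infinity>"
  shows "emeasure lborel {x \<in> \<Omega>. \<bar>f x\<bar> > y} < \<infinity>"
  using assms by (auto simp: eps_def ennreal_mult_less_top top.not_eq_extremum less_top)

text \<open>Near 0 and infinity \<open>eps\<close> is at most 1. For \<open>y\<close> between the
  thresholds \<open>a\<close> and \<open>b\<close>, the measure is at most the one at level
  \<open>a\<close> and \<open>y powr q\<close> is at most \<open>b powr q\<close>, which gives the
  finite bound \<open>?M\<close>.\<close>

lemma L0_space_subset_weak_L_space:
  assumes "open \<Omega>" "q > 0"
  shows "L0_space \<Omega> q \<subseteq> weak_L_space \<Omega> q"
proof
  fix F assume F: "F \<in> L0_space \<Omega> q"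
  then obtain f where f: "f \<in> borel_measurable (leb_on \<Omega>)" "F = ae_rel \<Omega> `` {f}"
    "(eps \<Omega> q f \<longlongrightarrow> 0) (at_right 0)" "(eps \<Omega> q f \<longlongrightarrow> 0) at_top"
    by (auto simp: L0_space_def quotient_def)
  obtain a b where ab: "0 < a" "a < b" "\<And>y. 0 < y \<Longrightarrow> y \<le> a \<Longrightarrow> eps \<Omega> q f y \<le> ennreal 1"
    "\<And>y. y \<ge> b \<Longrightarrow> eps \<Omega> q f y \<le> ennreal 1"
    using eps_small_outside[OF f(3,4) zero_less_one] by metis
  let ?M = "emeasure lborel {x \<in> \<Omega>. \<bar>f x\<bar> > a} * ennreal (b powr q)"
  have fin: "?M < \<infinity>"
    using emeasure_superlevel_finite[of a \<Omega> q f] ab(1) ab(3)[of a]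
    by (auto simp: ennreal_mult_less_top le_less_trans)
  have "eps \<Omega> q f y \<le> max 1 ?M" if "y > 0" for y
  proof (cases "a < y \<and> y < b")
    case True
    have "eps \<Omega> q f y \<le> ?M"
      unfolding eps_def using True ab(1) assms(2) superlevel_in_sets_lborel[OF assms(1) f(1)]
      by (intro mult_mono emeasure_mono ennreal_leI powr_mono2) auto
    then show ?thesis by (simp add: le_max_iff_disj)
  next
    case False
    then show ?thesis using ab(3)[of y] ab(4)[of y] that by (auto simp: le_max_iff_disj)
  qed
  then have "(SUP y\<in>{0<..}. eps \<Omega> q f y) \<le> max 1 ?M"
    by (intro SUP_least) auto
  also have "\<dots> < \<infinity>" using fin by auto
  finally show "F \<in> weak_L_space \<Omega> q"
    using weak_L_space_class_iff[OF assms(1) f(1)] f(2) by blast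
qed

text \<open>The truncation is bounded by \<open>b\<close> where it is nonzero, and it vanishes off a
  set of finite measure.\<close>

lemma truncation_in_L:
  fixes a b :: real
  assumes "open \<Omega>" and f: "f \<in> borel_measurable (leb_on \<Omega>)" and "q > 0"
    and fin: "emeasure lborel {x \<in> \<Omega>. \<bar>f x\<bar> > a} < \<infinity>"
  defines "g \<equiv> \<lambda>x. if a < \<bar>f x\<bar> \<and> \<bar>f x\<bar> \<le> b then f x else 0"
  shows "g \<in> borel_measurable (leb_on \<Omega>)"
    and "(\<integral>\<^sup>+x. ennreal (\<bar>g x\<bar> powr q) \<partial>leb_on \<Omega>) < \<infinity>"
proof -
  note [measurable] = f
  show "g \<in> borel_measurable (leb_on \<Omega>)"
    unfolding g_def by measurable
  let ?S = "{x \<in> \<Omega>. \<bar>f x\<bar> > a}"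
  have m: "?S \<in> sets (leb_on \<Omega>)"
    using superlevel_in_sets_lborel[OF assms(1) f] assms(1) by (auto simp: sets_restrict_space_iff)
  have "(\<integral>\<^sup>+x. ennreal (\<bar>g x\<bar> powr q) \<partial>leb_on \<Omega>) \<le>
      (\<integral>\<^sup>+x. ennreal (b powr q) * indicator ?S x \<partial>leb_on \<Omega>)"
    using \<open>q > 0\<close> by (intro nn_integral_mono)
      (auto simp: g_def indicator_def space_restrict_space intro!: ennreal_leI powr_mono2)
  also have "\<dots> = ennreal (b powr q) * emeasure (leb_on \<Omega>) ?S"
    using m by (rule nn_integral_cmult_indicator)
  also have "emeasure (leb_on \<Omega>) ?S = emeasure lborel ?S"
    using assms(1) by (intro emeasure_restrict_space) auto
  also have "ennreal (b powr q) * emeasure lborel ?S < \<infinity>"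
    using fin by (auto simp: ennreal_mult_less_top)
  finally show "(\<integral>\<^sup>+x. ennreal (\<bar>g x\<bar> powr q) \<partial>leb_on \<Omega>) < \<infinity>" .
qed

text \<open>The error is \<open>- f\<close> where |f| lies outside the window from \<open>a\<close>
  to \<open>b\<close> and 0 inside it. So only the values of \<open>eps\<close> at levels up to
  \<open>a\<close> or from \<open>b\<close> on enter the bound.\<close>

lemma eps_truncation_error_le:
  assumes "open \<Omega>" and f: "f \<in> borel_measurable (leb_on \<Omega>)" and "q > 0" "0 < a" "a < b"
    and low: "\<And>y. 0 < y \<Longrightarrow> y \<le> a \<Longrightarrow> eps \<Omega> q f y \<le> ennreal e"
    and high: "\<And>y. y \<ge> b \<Longrightarrow> eps \<Omega> q f y \<le> ennreal e"
    and "y > 0"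
  shows "eps \<Omega> q (\<lambda>x. (if a < \<bar>f x\<bar> \<and> \<bar>f x\<bar> \<le> b then f x else 0) - f x) y \<le> ennreal e"
    (is "eps \<Omega> q ?h y \<le> _")
proof (cases "y \<le> a \<or> y \<ge> b")
  case True
  have "eps \<Omega> q ?h y \<le> eps \<Omega> q f y"
    unfolding eps_def using \<open>y > 0\<close> superlevel_in_sets_lborel[OF assms(1) f]
    by (intro mult_right_mono emeasure_mono) (auto split: if_splits)
  with True low[of y] high[of y] \<open>y > 0\<close> show ?thesis by (auto intro: order_trans)
next
  case False
  \<comment> \<open>Here \<open>a < y < b\<close>. An error larger than \<open>y\<close> cannot come
    from points with |f| at most \<open>a\<close>, so it forces |f| > \<open>b\<close>; moreover
    \<open>y powr q\<close> is at most \<open>b powr q\<close>.\<close>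
  have "eps \<Omega> q ?h y \<le> eps \<Omega> q f b"
    unfolding eps_def using False \<open>y > 0\<close> \<open>q > 0\<close> superlevel_in_sets_lborel[OF assms(1) f]
    by (intro mult_mono emeasure_mono ennreal_leI powr_mono2) (auto split: if_splits)
  with high[of b] show ?thesis by auto
qed

lemma L0_space_subset_closure:
  assumes "open \<Omega>" "q > 0"
  shows "L0_space \<Omega> q \<subseteq> weak_topology \<Omega> q closure_of L_space \<Omega> q"
proof
  fix F assume F: "F \<in> L0_space \<Omega> q"
  then obtain f where f: "f \<in> borel_measurable (leb_on \<Omega>)" "F = ae_rel \<Omega> `` {f}"
    "(eps \<Omega> q f \<longlongrightarrow> 0) (at_right 0)" "(eps \<Omega> q f \<longlongrightarrow> 0) at_top"
    by (auto simp: L0_space_def quotient_def)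
  have Fw: "F \<in> weak_L_space \<Omega> q"
    using F L0_space_subset_weak_L_space[OF assms] by blast
  show "F \<in> weak_topology \<Omega> q closure_of L_space \<Omega> q"
    unfolding in_closure_of topspace_weak_topology openin_weak_topology
  proof (intro conjI Fw allI impI)
    fix U assume "F \<in> U \<and> weak_open \<Omega> q U"
    \<comment> \<open>By definition an open set contains a quasi-norm ball around each of its
      points, so it is enough to find an element of \<open>L_space\<close> in this ball.\<close>
    then obtain d where d: "d > 0"
      "\<And>G. G \<in> weak_L_space \<Omega> q \<Longrightarrow> weak_norm \<Omega> q (class_diff \<Omega> G F) < d \<Longrightarrow> G \<in> U"
      unfolding weak_open_def by blast
    \<comment> \<open>A bound by \<open>e\<close> for every \<open>y\<close> only makes the supremum
      at most \<open>e\<close>; the half leaves room for the strict inequality below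
      \<open>d powr q\<close>.\<close>
    define e where "e = d powr q / 2"
    have e: "e > 0" "e < d powr q" using d(1) by (auto simp: e_def)
    obtain a b where ab: "0 < a" "a < b" "\<And>y. 0 < y \<Longrightarrow> y \<le> a \<Longrightarrow> eps \<Omega> q f y \<le> ennreal e"
      "\<And>y. y \<ge> b \<Longrightarrow> eps \<Omega> q f y \<le> ennreal e"
      using eps_small_outside[OF f(3,4) e(1)] by metis
    define g where "g = (\<lambda>x. if a < \<bar>f x\<bar> \<and> \<bar>f x\<bar> \<le> b then f x else 0)"
    have "eps \<Omega> q f a < \<infinity>" using ab(1) ab(3)[of a] by (auto simp: le_less_trans)
    then have g: "g \<in> borel_measurable (leb_on \<Omega>)"
      "(\<integral>\<^sup>+x. ennreal (\<bar>g x\<bar> powr q) \<partial>leb_on \<Omega>) < \<infinity>"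
      unfolding g_def using truncation_in_L[OF assms(1) f(1) assms(2)]
        emeasure_superlevel_finite[OF ab(1)] by blast+
    let ?G = "ae_rel \<Omega> `` {g}"
    have GL: "?G \<in> L_space \<Omega> q"
      unfolding L_space_def using g by (auto intro!: quotientI)
    then have Gw: "?G \<in> weak_L_space \<Omega> q"
      using L_space_subset_L0_space[OF assms] L0_space_subset_weak_L_space[OF assms] by blast
    have "(SUP y\<in>{0<..}. eps \<Omega> q (\<lambda>x. g x - f x) y) \<le> ennreal e"
      unfolding g_def using eps_truncation_error_le[OF assms(1) f(1) assms(2) ab]
      by (intro SUP_least) auto
    also have "\<dots> < ennreal (d powr q)" using e by (auto simp: ennreal_less_iff)
    finally have "weak_norm_fun \<Omega> q (\<lambda>x. g x - f x) < d"
      using d(1) assms(2) by (subst weak_norm_fun_less_iff) (auto intro: less_trans)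
    then have "weak_norm \<Omega> q (class_diff \<Omega> ?G F) < d"
      using f(1) g(1) by (simp add: f(2) class_diff_class weak_norm_class assms(1))
    then show "\<exists>G. G \<in> L_space \<Omega> q \<and> G \<in> U"
      using GL Gw d(2) by blast
  qed
qed

section \<open>Closedness of \<open>L0_space\<close>\<close>

text \<open>The approximation is uniform in \<open>y\<close>, so the zero limit passes from
  \<open>g\<close> to \<open>f\<close> through the quasi-triangle inequality. That inequality
  evaluates at \<open>y / 2\<close>, hence the filter has to be stable under halving; this covers
  \<open>at_right 0\<close> and \<open>at_top\<close> together.\<close>

lemma eps_tendsto_zero_of_approx:
  assumes "open \<Omega>" and f: "f \<in> borel_measurable (leb_on \<Omega>)"
    and approx: "\<And>e. e > 0 \<Longrightarrow> \<exists>g \<in> borel_measurable (leb_on \<Omega>). (eps \<Omega> q g \<longlongrightarrow> 0) F \<and>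
      (\<forall>y>0. eps \<Omega> q (\<lambda>x. g x - f x) y \<le> ennreal e)"
    and F: "eventually (\<lambda>y. y > 0) F" "filterlim (\<lambda>y. y / 2) F F"
  shows "(eps \<Omega> q f \<longlongrightarrow> 0) F"
proof (rule tendsto_zero_ennrealI)
  fix e :: real assume "e > 0"
  define d where "d = e / (2 * 2 powr q)"
  have d: "d > 0" "2 powr q * (d + d) = e" using \<open>e > 0\<close> by (auto simp: d_def)
  obtain g where g: "g \<in> borel_measurable (leb_on \<Omega>)" "(eps \<Omega> q g \<longlongrightarrow> 0) F"
    "\<And>y. y > 0 \<Longrightarrow> eps \<Omega> q (\<lambda>x. g x - f x) y \<le> ennreal d"
    using approx[OF d(1)] by blast
  have "eventually (\<lambda>y. eps \<Omega> q g (y / 2) \<le> ennreal d) F"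
    using tendsto_zero_ennrealD[OF filterlim_compose[OF g(2) F(2)] d(1)] .
  with F(1) show "eventually (\<lambda>y. eps \<Omega> q f y \<le> ennreal e) F"
  proof eventually_elim
    case (elim y)
    \<comment> \<open>Uses \<open>f = g - (g - f)\<close>; \<open>d\<close> was chosen so that the
      two contributions and the factor \<open>2 powr q\<close> combine to \<open>e\<close>.\<close>
    have "eps \<Omega> q f y \<le>
        ennreal (2 powr q) * (eps \<Omega> q (\<lambda>x. g x - f x) (y / 2) + eps \<Omega> q g (y / 2))"
      using elim f g(1) by (intro eps_triangle assms(1)) auto
    also have "\<dots> \<le> ennreal (2 powr q) * (ennreal d + ennreal d)"
      using elim g(3)[of "y/2"] by (intro mult_left_mono add_mono) auto
    also have "\<dots> = ennreal e"
      using d by (metis ennreal_plus ennreal_mult powr_ge_zero less_imp_le add_nonneg_nonneg)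
    finally show ?case .
  qed
qed

lemma closedin_L0_space:
  assumes "open \<Omega>" "q > 0"
  shows "closedin (weak_topology \<Omega> q) (L0_space \<Omega> q)"
proof -
  have "weak_open \<Omega> q (weak_L_space \<Omega> q - L0_space \<Omega> q)"
    unfolding weak_open_def
  proof (intro conjI ballI)
    fix F assume F: "F \<in> weak_L_space \<Omega> q - L0_space \<Omega> q"
    then obtain f where f: "f \<in> borel_measurable (leb_on \<Omega>)" "F = ae_rel \<Omega> `` {f}"
      "(SUP y\<in>{0<..}. eps \<Omega> q f y) < \<infinity>"
      by (auto simp: weak_L_space_def quotient_def)
    show "\<exists>e>0. \<forall>G\<in>weak_L_space \<Omega> q. weak_norm \<Omega> q (class_diff \<Omega> G F) < e \<longrightarrow>
        G \<in> weak_L_space \<Omega> q - L0_space \<Omega> q"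
    \<comment> \<open>If every ball around \<open>F\<close> meets \<open>L0_space\<close>, then
      \<open>f\<close> is approximated by representatives from there, and both limit conditions pass
      to \<open>f\<close>.\<close>
    proof (rule ccontr)
      assume neg: "\<not> ?thesis"
      have approx: "\<exists>g \<in> borel_measurable (leb_on \<Omega>).
          ((eps \<Omega> q g \<longlongrightarrow> 0) (at_right 0) \<and> (eps \<Omega> q g \<longlongrightarrow> 0) at_top) \<and>
          (\<forall>y>0. eps \<Omega> q (\<lambda>x. g x - f x) y \<le> ennreal d)" if "d > 0" for d :: real
      proof -
        \<comment> \<open>The radius whose \<open>q\<close>-th power is \<open>d\<close>, so that a
          smaller quasi-norm means a supremum of \<open>eps\<close> below \<open>d\<close>.\<close>
        have "d powr (1/q) > 0" using that by simp
        then obtain G where G: "G \<in> L0_space \<Omega> q"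
          "weak_norm \<Omega> q (class_diff \<Omega> G F) < d powr (1/q)"
          using neg by blast
        then obtain g where g: "g \<in> borel_measurable (leb_on \<Omega>)" "G = ae_rel \<Omega> `` {g}"
          "(eps \<Omega> q g \<longlongrightarrow> 0) (at_right 0)" "(eps \<Omega> q g \<longlongrightarrow> 0) at_top"
          by (auto simp: L0_space_def quotient_def)
        have gfin: "(SUP y\<in>{0<..}. eps \<Omega> q g y) < \<infinity>"
          using G(1) L0_space_subset_weak_L_space[OF assms]
            weak_L_space_class_iff[OF assms(1) g(1)] g(2) by blast
        \<comment> \<open>The supremum for the difference must first be shown finite, from those of
          \<open>g\<close> and \<open>f\<close>: only then does the small real-valued quasi-norm
          control \<open>eps\<close>.\<close>
        let ?S = "SUP y\<in>{0<..}. eps \<Omega> q (\<lambda>x. g x - f x) y"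
        have "eps \<Omega> q (\<lambda>x. g x - f x) y \<le> ennreal (2 powr q) *
            ((SUP y\<in>{0<..}. eps \<Omega> q g y) + (SUP y\<in>{0<..}. eps \<Omega> q f y))" if "y > 0" for y
        proof -
          have "eps \<Omega> q (\<lambda>x. g x - f x) y \<le>
              ennreal (2 powr q) * (eps \<Omega> q g (y / 2) + eps \<Omega> q f (y / 2))"
            using that f(1) g(1) by (intro eps_triangle assms(1)) auto
          also have "\<dots> \<le> ennreal (2 powr q) *
              ((SUP y\<in>{0<..}. eps \<Omega> q g y) + (SUP y\<in>{0<..}. eps \<Omega> q f y))"
            using that by (intro mult_left_mono add_mono eps_le_Sup) auto
          finally show ?thesis .
        qed
        then have "?S \<le> ennreal (2 powr q) *
            ((SUP y\<in>{0<..}. eps \<Omega> q g y) + (SUP y\<in>{0<..}. eps \<Omega> q f y))"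
          by (intro SUP_least) auto
        also have "\<dots> < \<infinity>" using f(3) gfin by (auto simp: ennreal_mult_less_top)
        finally have fin: "?S < \<infinity>" .
        have "weak_norm_fun \<Omega> q (\<lambda>x. g x - f x) < d powr (1/q)"
          using G(2) f(1) g(1) by (simp add: f(2) g(2) class_diff_class weak_norm_class assms(1))
        then have "?S < ennreal d"
          using weak_norm_fun_less_iff[OF fin assms(2), of "d powr (1/q)"] that assms(2)
          by (simp add: powr_powr)
        then have "\<forall>y>0. eps \<Omega> q (\<lambda>x. g x - f x) y \<le> ennreal d"
          using eps_le_Sup by (meson less_imp_le order_trans)
        then show ?thesis using g by blast
      qed
      have "(eps \<Omega> q f \<longlongrightarrow> 0) (at_right 0)"
      proof (rule eps_tendsto_zero_of_approx[OF assms(1) f(1)])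
        show "filterlim (\<lambda>y::real. y / 2) (at_right 0) (at_right 0)"
          by (rule filterlim_at_withinI)
            (auto intro!: tendsto_eq_intros eventually_at_right_less[THEN eventually_mono])
      qed (use approx eventually_at_right_less in blast)+
      moreover have "(eps \<Omega> q f \<longlongrightarrow> 0) at_top"
      proof (rule eps_tendsto_zero_of_approx[OF assms(1) f(1)])
        show "filterlim (\<lambda>y::real. y / 2) at_top at_top"
          using filterlim_tendsto_pos_mult_at_top[OF tendsto_const[of "1/2::real"] _ filterlim_ident]
          by simp
      qed (use approx eventually_gt_at_top in blast)+
      ultimately have "F \<in> L0_space \<Omega> q"
        using L0_space_class_iff[OF assms(1) f(1)] f(2) by blast
      with F show False by blast
    qed
  qed auto
  then show ?thesis
    using L0_space_subset_weak_L_space[OF assms]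
    by (simp add: closedin_def topspace_weak_topology openin_weak_topology)
qed

theorem mainTheorem18:
  fixes \<Omega> :: "(real ^ 'm) set" and q :: real
  assumes "CARD('m) \<ge> 2"
    and "open \<Omega>" and "\<Omega> \<noteq> {}"
    and "1 < q"
  shows "weak_topology \<Omega> q closure_of L_space \<Omega> q = L0_space \<Omega> q"
proof
  have "q > 0" using assms(4) by simp
  then show "weak_topology \<Omega> q closure_of L_space \<Omega> q \<subseteq> L0_space \<Omega> q"
    "L0_space \<Omega> q \<subseteq> weak_topology \<Omega> q closure_of L_space \<Omega> q"
    using closure_of_minimal[OF L_space_subset_L0_space closedin_L0_space]
      L0_space_subset_closure assms(2) by blast+
qed

end
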